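(* Suppose that the spins are positively correlated under the Gibbs measure, that is, $$\langle\sigma_i\sigma_j\rangle\geq\langle\sigma_i\rangle\langle\sigma_j\rangle\quad\text{for all } i,j\in V.$$ Then $$\mathbb{E}\Bigl\langle\bigl(R_{1,2}-\langle R_{1,2}\rangle\bigr)^2\Bigr\rangle\leq\frac{2}{h\sqrt{|V|}}.$$
   Context: Let $V$ be a finite nonempty set and $h>0$. Consider the (random) Hamiltonian on $\sigma=(\sigma_i)_{i\in V}\in\{-1,+1\}^V$, $$H(\sigma)=H'(\sigma)+h\sum_{i\in V}g_i\sigma_i,$$ where $(g_i)_{i\in V}$ are i.i.d. standard Gaussian random variables and $H'$ is an arbitrary (possibly random) real-valued function on $\{-1,+1\}^V$ independent of $(g_i)_{i\in V}$. The Gibbs measure is $G(\sigma)=\exp(H(\sigma))/Z$ with $Z=\sum_{\sigma}\exp H(\sigma)$. Let $\sigma^1,\sigma^2$ be two independent samples (replicas) from $G$ (for fixed disorder), let $\langle\,\cdot\,\rangle$ denote the average with respect to $G$ (or $G^{\otimes2}$ for functions of two replicas), and let $\mathbb{E}$ denote expectation over all the disorder. The positive correlation condition is assumed to hold almost surely with respect to the disorder. The site overlap is $$R_{1,2}=\frac{1}{|V|}\sum_{i\in V}\sigma_i^1\sigma_i^2.$$ *)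

theory Defs
  imports "HOL-Probability.Probability"
begin

text \<open>Elements of \<open>PiE\<close> are \<open>undefined\<close> off \<open>V\<close>, so that spin configurations form a finite set
  with exactly \<open>2 ^ card V\<close> elements.\<close>

definition configs :: "'v set \<Rightarrow> ('v \<Rightarrow> real) set" where
  "configs V = (\<Pi>\<^sub>E i\<in>V. {-1, 1})"

text \<open>The arguments \<open>H'\<close> and \<open>g\<close> are one realization of the disorder.\<close>

definition hamiltonian ::
  "'v set \<Rightarrow> real \<Rightarrow> (('v \<Rightarrow> real) \<Rightarrow> real) \<Rightarrow> ('v \<Rightarrow> real) \<Rightarrow> ('v \<Rightarrow> real) \<Rightarrow> real" where
  "hamiltonian V h H' g \<sigma> = H' \<sigma> + h * (\<Sum>i\<in>V. g i * \<sigma> i)"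

definition partition_fun :: "'v set \<Rightarrow> (('v \<Rightarrow> real) \<Rightarrow> real) \<Rightarrow> real" where
  "partition_fun V H = (\<Sum>\<sigma>\<in>configs V. exp (H \<sigma>))"

definition gibbs :: "'v set \<Rightarrow> (('v \<Rightarrow> real) \<Rightarrow> real) \<Rightarrow> ('v \<Rightarrow> real) pmf" where
  "gibbs V H = embed_pmf (\<lambda>\<sigma>. if \<sigma> \<in> configs V then exp (H \<sigma>) / partition_fun V H else 0)"

definition gibbs_avg ::
  "'v set \<Rightarrow> (('v \<Rightarrow> real) \<Rightarrow> real) \<Rightarrow> (('v \<Rightarrow> real) \<Rightarrow> real) \<Rightarrow> real" where
  "gibbs_avg V H f = measure_pmf.expectation (gibbs V H) f"

definition gibbs_avg2 ::
  "'v set \<Rightarrow> (('v \<Rightarrow> real) \<Rightarrow> real) \<Rightarrow> (('v \<Rightarrow> real) \<Rightarrow> ('v \<Rightarrow> real) \<Rightarrow> real) \<Rightarrow> real" where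
  "gibbs_avg2 V H f =
     measure_pmf.expectation (pair_pmf (gibbs V H) (gibbs V H)) (\<lambda>(\<sigma>1, \<sigma>2). f \<sigma>1 \<sigma>2)"

definition overlap :: "'v set \<Rightarrow> ('v \<Rightarrow> real) \<Rightarrow> ('v \<Rightarrow> real) \<Rightarrow> real" where
  "overlap V \<sigma>1 \<sigma>2 = (\<Sum>i\<in>V. \<sigma>1 i * \<sigma>2 i) / real (card V)"

text \<open>The library's \<open>indep_var\<close> forces both random variables to take values in the same type; this
  is the same notion for two value types.\<close>

definition indep_rvs ::
  "'w measure \<Rightarrow> 'a measure \<Rightarrow> ('w \<Rightarrow> 'a) \<Rightarrow> 'b measure \<Rightarrow> ('w \<Rightarrow> 'b) \<Rightarrow> bool" where
  "indep_rvs M S X T Y \<longleftrightarrow>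
     X \<in> measurable M S \<and> Y \<in> measurable M T \<and>
     prob_space.indep_set M
       (sigma_sets (space M) {X -` A \<inter> space M | A. A \<in> sets S})
       (sigma_sets (space M) {Y -` A \<inter> space M | A. A \<in> sets T})"

lemma (in prob_space) indep_rvs_eq_indep_var:
  "indep_rvs M S X T Y \<longleftrightarrow> indep_var S X T Y"
  unfolding indep_rvs_def indep_var_eq by blast

lemma finite_configs: "finite V \<Longrightarrow> finite (configs V)"
  unfolding configs_def by (rule finite_PiE) auto

lemma configs_nonempty: "configs V \<noteq> {}"
  unfolding configs_def by (auto simp: PiE_eq_empty_iff)

lemma partition_fun_pos: "finite V \<Longrightarrow> partition_fun V H > 0"
  unfolding partition_fun_def
  by (rule sum_pos) (auto simp: finite_configs configs_nonempty)

text \<open>The side conditions of \<^const>\<open>embed_pmf\<close> hold, so \<^const>\<open>gibbs\<close> has the intended mass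
  function.\<close>

lemma pmf_gibbs:
  assumes "finite V"
  shows "pmf (gibbs V H) \<sigma> = (if \<sigma> \<in> configs V then exp (H \<sigma>) / partition_fun V H else 0)"
proof -
  let ?Z = "partition_fun V H"
  let ?f = "\<lambda>\<sigma>. if \<sigma> \<in> configs V then exp (H \<sigma>) / ?Z else 0"
  have Z: "?Z > 0" using assms by (rule partition_fun_pos)
  have nonneg: "0 \<le> ?f \<sigma>" for \<sigma> using Z by simp
  have "(\<integral>\<^sup>+\<sigma>. ennreal (?f \<sigma>) \<partial>count_space UNIV) = (\<Sum>\<sigma>\<in>configs V. ennreal (?f \<sigma>))"
    by (rule nn_integral_count_space') (auto simp: finite_configs[OF assms])
  also have "\<dots> = ennreal (\<Sum>\<sigma>\<in>configs V. ?f \<sigma>)"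
    by (rule sum_ennreal) (rule nonneg)
  also have "(\<Sum>\<sigma>\<in>configs V. ?f \<sigma>) = (\<Sum>\<sigma>\<in>configs V. exp (H \<sigma>)) / ?Z"
    by (simp add: sum_divide_distrib)
  also have "\<dots> = 1" using Z by (simp add: partition_fun_def)
  finally show ?thesis
    unfolding gibbs_def by (subst pmf_embed_pmf) (use nonneg in auto)
qed

end

theory Submission
  imports Defs "HOL-Real_Asymp.Real_Asymp"
begin

text \<open>Write \<open>C\<^sub>i\<^sub>j\<close> for the Gibbs covariance of \<open>\<sigma>\<^sub>i\<close> and \<open>\<sigma>\<^sub>j\<close>, and \<open>n\<close> for the number of sites.
  The variance of the overlap is
  \<open>n\<^sup>-\<^sup>2 \<Sum>\<^sub>i\<^sub>j (\<langle>\<sigma>\<^sub>i\<sigma>\<^sub>j\<rangle>\<^sup>2 - \<langle>\<sigma>\<^sub>i\<rangle>\<^sup>2\<langle>\<sigma>\<^sub>j\<rangle>\<^sup>2) = n\<^sup>-\<^sup>2 \<Sum>\<^sub>i\<^sub>j C\<^sub>i\<^sub>j (\<langle>\<sigma>\<^sub>i\<sigma>\<^sub>j\<rangle> + \<langle>\<sigma>\<^sub>i\<rangle>\<langle>\<sigma>\<^sub>j\<rangle>)\<close>,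
  which positive correlation bounds by \<open>2 n\<^sup>-\<^sup>2 \<Sum>\<^sub>i\<^sub>j C\<^sub>i\<^sub>j\<close>. Since \<open>h C\<^sub>i\<^sub>j\<close> is the derivative of
  \<open>\<langle>\<sigma>\<^sub>i\<rangle>\<close> in \<open>g\<^sub>j\<close>, Gaussian integration by parts turns \<open>h E \<Sum>\<^sub>i\<^sub>j C\<^sub>i\<^sub>j\<close> into
  \<open>E (\<Sum>\<^sub>j g\<^sub>j) (\<Sum>\<^sub>i \<langle>\<sigma>\<^sub>i\<rangle>)\<close>, at most \<open>n E \<bar>\<Sum>\<^sub>j g\<^sub>j\<bar> \<le> n \<surd>n\<close>.\<close>

section \<open>Gibbs averages\<close>

text \<open>The support is finite, so every observable is integrable. As a simp rule this discharges
  the side conditions of linearity wherever averages are expanded.\<close>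

lemma integrable_gibbs [simp]:
  fixes f :: "('v \<Rightarrow> real) \<Rightarrow> real"
  assumes "finite V"
  shows "integrable (measure_pmf (gibbs V H)) f"
proof (rule integrable_measure_pmf_finite)
  have "set_pmf (gibbs V H) \<subseteq> configs V"
    by (auto simp: set_pmf_iff pmf_gibbs[OF assms] split: if_splits)
  then show "finite (set_pmf (gibbs V H))"
    using finite_configs[OF assms] by (rule finite_subset)
qed

lemma gibbs_avg_eq_sum:
  assumes "finite V"
  shows "gibbs_avg V H f = (\<Sum>\<sigma>\<in>configs V. f \<sigma> * exp (H \<sigma>)) / (\<Sum>\<sigma>\<in>configs V. exp (H \<sigma>))"
proof -
  have "gibbs_avg V H f = (\<Sum>\<sigma>\<in>configs V. f \<sigma> * pmf (gibbs V H) \<sigma>)"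
    unfolding gibbs_avg_def
    by (rule integral_measure_pmf_real)
      (auto simp: finite_configs[OF assms] set_pmf_iff pmf_gibbs[OF assms] split: if_splits)
  also have "\<dots> = (\<Sum>\<sigma>\<in>configs V. f \<sigma> * exp (H \<sigma>) / partition_fun V H)"
    by (rule sum.cong) (auto simp: pmf_gibbs[OF assms])
  finally show ?thesis
    by (simp add: sum_divide_distrib partition_fun_def)
qed

text \<open>Used when the disorder is replaced by its restrictions to \<open>configs V\<close> and
  \<open>V\<close>, which change the Hamiltonian only off \<open>configs V\<close>.\<close>

lemma gibbs_avg_cong:
  assumes "finite V" and "\<And>\<sigma>. \<sigma> \<in> configs V \<Longrightarrow> H \<sigma> = H' \<sigma>"
    and "\<And>\<sigma>. \<sigma> \<in> configs V \<Longrightarrow> f \<sigma> = f' \<sigma>"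
  shows "gibbs_avg V H f = gibbs_avg V H' f'"
  using assms by (simp add: gibbs_avg_eq_sum cong: sum.cong)

lemma abs_gibbs_avg_le:
  assumes V: "finite V" and B: "\<And>\<sigma>. \<sigma> \<in> configs V \<Longrightarrow> \<bar>f \<sigma>\<bar> \<le> B"
  shows "\<bar>gibbs_avg V H f\<bar> \<le> B"
proof -
  let ?Z = "\<Sum>\<sigma>\<in>configs V. exp (H \<sigma>)"
  have Z: "?Z > 0"
    using partition_fun_pos[OF V, of H] by (simp add: partition_fun_def)
  have "\<bar>\<Sum>\<sigma>\<in>configs V. f \<sigma> * exp (H \<sigma>)\<bar> \<le> (\<Sum>\<sigma>\<in>configs V. \<bar>f \<sigma> * exp (H \<sigma>)\<bar>)"
    by (rule sum_abs)
  also have "\<dots> \<le> (\<Sum>\<sigma>\<in>configs V. B * exp (H \<sigma>))"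
    by (rule sum_mono) (auto simp: abs_mult intro!: mult_right_mono B)
  also have "\<dots> = B * ?Z"
    by (simp add: sum_distrib_left)
  finally show ?thesis
    using Z by (simp add: gibbs_avg_eq_sum[OF V] pos_divide_le_eq)
qed

lemma abs_config_le:
  "\<sigma> \<in> configs V \<Longrightarrow> i \<in> V \<Longrightarrow> \<bar>\<sigma> i\<bar> \<le> 1"
  by (fastforce simp: configs_def dest: PiE_mem)

text \<open>The arguments are observables rather than sites because integration by parts is applied
  to the total spin paired with a single spin.\<close>

definition gibbs_cov ::
  "'v set \<Rightarrow> (('v \<Rightarrow> real) \<Rightarrow> real) \<Rightarrow> (('v \<Rightarrow> real) \<Rightarrow> real) \<Rightarrow> (('v \<Rightarrow> real) \<Rightarrow> real) \<Rightarrow> real" where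
  "gibbs_cov V H f1 f2 = gibbs_avg V H (\<lambda>\<sigma>. f1 \<sigma> * f2 \<sigma>) - gibbs_avg V H f1 * gibbs_avg V H f2"

lemma abs_gibbs_cov_le:
  assumes V: "finite V" and A: "\<And>\<sigma>. \<sigma> \<in> configs V \<Longrightarrow> \<bar>f1 \<sigma>\<bar> \<le> A"
    and B: "\<And>\<sigma>. \<sigma> \<in> configs V \<Longrightarrow> \<bar>f2 \<sigma>\<bar> \<le> B"
  shows "\<bar>gibbs_cov V H f1 f2\<bar> \<le> 2 * (A * B)"
proof -
  \<comment> \<open>Evaluating the bound at one configuration gives \<open>0 \<le> A\<close>, which
    monotonicity of products requires.\<close>
  obtain \<sigma> where "\<sigma> \<in> configs V"
    using configs_nonempty by blast
  then have "A \<ge> 0"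
    using A by (meson abs_ge_zero order_trans)
  then have "\<bar>gibbs_avg V H (\<lambda>\<sigma>. f1 \<sigma> * f2 \<sigma>)\<bar> \<le> A * B"
    by (intro abs_gibbs_avg_le V) (auto simp: abs_mult intro!: mult_mono A B)
  moreover have "\<bar>gibbs_avg V H f1 * gibbs_avg V H f2\<bar> \<le> A * B"
    unfolding abs_mult using \<open>A \<ge> 0\<close> by (intro mult_mono abs_gibbs_avg_le A B V) auto
  ultimately show ?thesis
    unfolding gibbs_cov_def by linarith
qed

section \<open>Two replicas and the variance of the overlap\<close>

lemma gibbs_avg2_iterated:
  assumes V: "finite V"
  shows "gibbs_avg2 V H F = gibbs_avg V H (\<lambda>\<sigma>1. gibbs_avg V H (F \<sigma>1))"
proof -
  let ?p = "gibbs V H" and ?C = "configs V"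
  have "gibbs_avg2 V H F = (\<Sum>x\<in>?C \<times> ?C. (case x of (a, b) \<Rightarrow> F a b) * pmf (pair_pmf ?p ?p) x)"
    unfolding gibbs_avg2_def
    by (rule integral_measure_pmf_real)
      (auto simp: finite_configs[OF V] set_pmf_iff pmf_gibbs[OF V] split: if_splits)
  also have "\<dots> = (\<Sum>a\<in>?C. \<Sum>b\<in>?C. F a b * (pmf ?p a * pmf ?p b))"
    unfolding sum.cartesian_product by (rule sum.cong) (auto simp: pmf_pair)
  also have "\<dots> = (\<Sum>a\<in>?C. (\<Sum>b\<in>?C. F a b * pmf ?p b) * pmf ?p a)"
    unfolding sum_distrib_right by (simp only: mult_ac)
  also have "\<dots> = (\<Sum>a\<in>?C. gibbs_avg V H (F a) * pmf ?p a)"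
    unfolding gibbs_avg_def
    by (intro sum.cong refl arg_cong2[where f = "(*)"] integral_measure_pmf_real[symmetric])
      (auto simp: finite_configs[OF V] set_pmf_iff pmf_gibbs[OF V] split: if_splits)
  also have "\<dots> = gibbs_avg V H (\<lambda>a. gibbs_avg V H (F a))"
    unfolding gibbs_avg_def
    by (rule integral_measure_pmf_real[symmetric])
      (auto simp: finite_configs[OF V] set_pmf_iff pmf_gibbs[OF V] split: if_splits)
  finally show ?thesis .
qed

text \<open>Replicas are independent and identically distributed, so each product averages to a
  square. The index set is left free to cover both the overlap (sites) and its square (pairs of
  sites).\<close>

lemma gibbs_avg2_sum_prod:
  assumes V: "finite V"
  shows "gibbs_avg2 V H (\<lambda>\<sigma>1 \<sigma>2. (\<Sum>k\<in>K. f k \<sigma>1 * f k \<sigma>2) / c)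
    = (\<Sum>k\<in>K. (gibbs_avg V H (f k))\<^sup>2) / c"
  using V by (simp add: gibbs_avg2_iterated gibbs_avg_def power2_eq_square)

lemma overlap_variance_le:
  assumes V: "finite V"
    and pos: "\<And>i j. i \<in> V \<Longrightarrow> j \<in> V \<Longrightarrow> gibbs_cov V H (\<lambda>\<sigma>. \<sigma> i) (\<lambda>\<sigma>. \<sigma> j) \<ge> 0"
  shows "gibbs_avg2 V H (\<lambda>\<sigma>1 \<sigma>2. (overlap V \<sigma>1 \<sigma>2 - gibbs_avg2 V H (overlap V))\<^sup>2)
    \<le> 2 / (real (card V))\<^sup>2 * (\<Sum>i\<in>V. \<Sum>j\<in>V. gibbs_cov V H (\<lambda>\<sigma>. \<sigma> i) (\<lambda>\<sigma>. \<sigma> j))"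
proof -
  let ?n = "real (card V)"
  let ?m = "\<lambda>i. gibbs_avg V H (\<lambda>\<sigma>. \<sigma> i)"
  let ?p = "\<lambda>i j. gibbs_avg V H (\<lambda>\<sigma>. \<sigma> i * \<sigma> j)"
  let ?c = "\<lambda>i j. gibbs_cov V H (\<lambda>\<sigma>. \<sigma> i) (\<lambda>\<sigma>. \<sigma> j)"
  let ?r = "gibbs_avg2 V H (overlap V)"
  have r: "?r = (\<Sum>i\<in>V. (?m i)\<^sup>2) / ?n"
    using gibbs_avg2_sum_prod[OF V, of H "\<lambda>i \<sigma>. \<sigma> i" V ?n] by (simp add: overlap_def[abs_def])
  \<comment> \<open>Squaring the overlap gives a sum over pairs of sites that again factorizes
    between the replicas, with the observable \<open>\<sigma> i * \<sigma> j\<close>.\<close>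
  have sq: "gibbs_avg2 V H (\<lambda>\<sigma>1 \<sigma>2. (overlap V \<sigma>1 \<sigma>2)\<^sup>2) = (\<Sum>(i,j)\<in>V\<times>V. (?p i j)\<^sup>2) / ?n\<^sup>2"
  proof -
    have "(overlap V \<sigma>1 \<sigma>2)\<^sup>2
        = (\<Sum>k\<in>V\<times>V. (\<sigma>1 (fst k) * \<sigma>1 (snd k)) * (\<sigma>2 (fst k) * \<sigma>2 (snd k))) / ?n\<^sup>2"
      for \<sigma>1 \<sigma>2 :: "'a \<Rightarrow> real"
      by (simp add: overlap_def power_divide power2_eq_square sum_product sum.cartesian_product
          split_def mult_ac)
    then show ?thesis
      using gibbs_avg2_sum_prod[OF V, of H "\<lambda>k \<sigma>. \<sigma> (fst k) * \<sigma> (snd k)" "V\<times>V" "?n\<^sup>2"]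
      by (simp add: split_def)
  qed
  have "gibbs_avg2 V H (\<lambda>\<sigma>1 \<sigma>2. (overlap V \<sigma>1 \<sigma>2 - ?r)\<^sup>2)
      = gibbs_avg2 V H (\<lambda>\<sigma>1 \<sigma>2. (overlap V \<sigma>1 \<sigma>2)\<^sup>2) - ?r\<^sup>2"
    using V by (simp add: gibbs_avg2_iterated gibbs_avg_def power2_diff)
      (simp add: power2_eq_square algebra_simps)
  also have "\<dots> = (\<Sum>i\<in>V. \<Sum>j\<in>V. (?p i j)\<^sup>2 - (?m i)\<^sup>2 * (?m j)\<^sup>2) / ?n\<^sup>2"
    unfolding sq r
    by (simp add: power_divide sum_subtractf diff_divide_distrib sum.cartesian_product
        power2_eq_square[of "sum _ _"] sum_product)
  also have "\<dots> \<le> (\<Sum>i\<in>V. \<Sum>j\<in>V. 2 * ?c i j) / ?n\<^sup>2"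
  proof (intro divide_right_mono sum_mono)
    fix i j assume ij: "i \<in> V" "j \<in> V"
    have "\<bar>?m i * ?m j\<bar> \<le> 1 * 1"
      unfolding abs_mult using ij by (intro mult_mono abs_gibbs_avg_le V) (auto intro: abs_config_le)
    moreover have "\<bar>?p i j\<bar> \<le> 1"
      using ij by (intro abs_gibbs_avg_le V) (auto simp: abs_mult intro!: mult_le_one intro: abs_config_le)
    \<comment> \<open>Both terms lie in [-1, 1]; this is the source of the factor 2 in the
      theorem.\<close>
    ultimately have "?p i j + ?m i * ?m j \<le> 2"
      by linarith
    \<comment> \<open>Positive correlation enters here: the factor \<open>?c i j\<close> of the
      difference of squares must be nonnegative to preserve the inequality.\<close>
    then have "?c i j * (?p i j + ?m i * ?m j) \<le> ?c i j * 2"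
      using pos[OF ij] by (rule mult_left_mono)
    then show "(?p i j)\<^sup>2 - (?m i)\<^sup>2 * (?m j)\<^sup>2 \<le> 2 * ?c i j"
      by (simp add: gibbs_cov_def power2_eq_square algebra_simps)
  qed simp
  finally show ?thesis
    by (simp add: sum_distrib_left[symmetric])
qed

lemma gibbs_cov_sum:
  assumes "finite V"
  shows "gibbs_cov V H (\<lambda>\<sigma>. \<Sum>i\<in>I. f i \<sigma>) k = (\<Sum>i\<in>I. gibbs_cov V H (f i) k)"
  using assms
  by (simp add: gibbs_cov_def gibbs_avg_def sum_distrib_right sum_subtractf)

section \<open>Response of Gibbs averages to the field at one site\<close>

lemma hamiltonian_fun_upd:
  assumes "finite V" "j \<in> V"
  shows "hamiltonian V h K (y(j := z)) \<sigma>
    = K \<sigma> + h * (\<Sum>i\<in>V - {j}. y i * \<sigma> i) + h * z * \<sigma> j"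
proof -
  have "(\<Sum>i\<in>V. (y(j := z)) i * \<sigma> i) = z * \<sigma> j + (\<Sum>i\<in>V - {j}. y i * \<sigma> i)"
    unfolding sum.remove[OF assms] by (auto intro!: sum.cong)
  then show ?thesis
    by (simp add: hamiltonian_def algebra_simps)
qed

text \<open>The Hamiltonian is affine in the field at \<open>j\<close> with slope
  \<open>h * \<sigma> j\<close>. Differentiating each Boltzmann weight brings down this slope, and
  the quotient rule assembles the covariance.\<close>

lemma gibbs_avg_has_derivative_field:
  assumes V: "finite V" and j: "j \<in> V"
  shows "((\<lambda>z. gibbs_avg V (hamiltonian V h K (y(j := z))) f) has_real_derivative
    h * gibbs_cov V (hamiltonian V h K (y(j := z))) f (\<lambda>\<sigma>. \<sigma> j)) (at z)"
proof -
  \<comment> \<open>Weighted sums treat numerator and denominator alike: \<open>u = 1\<close> gives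
    the partition function.\<close>
  define S where
    "S u z = (\<Sum>\<sigma>\<in>configs V. u \<sigma> * exp (hamiltonian V h K (y(j := z)) \<sigma>))" for u z
  have S: "(S u has_real_derivative h * S (\<lambda>\<sigma>. u \<sigma> * \<sigma> j) z) (at z)" for u
    unfolding S_def hamiltonian_fun_upd[OF V j]
    by (auto intro!: derivative_eq_intros sum.cong simp: sum_distrib_left)
  have Z: "S (\<lambda>_. 1) z \<noteq> 0"
    using partition_fun_pos[OF V, of "hamiltonian V h K (y(j := z))"]
    by (simp add: partition_fun_def S_def)
  have avg: "gibbs_avg V (hamiltonian V h K (y(j := z))) u = S u z / S (\<lambda>_. 1) z" for u z
    by (simp add: gibbs_avg_eq_sum[OF V] S_def)
  show ?thesis
    unfolding gibbs_cov_def avg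
    by (rule DERIV_cong[OF DERIV_divide[OF S S Z]]) (use Z in \<open>simp add: field_simps\<close>)
qed

text \<open>A covariance is a polynomial in averages, so this yields the continuity of the
  derivative that integration by parts asks for.\<close>

lemma isCont_gibbs_avg_field:
  assumes "finite V" "j \<in> V"
  shows "isCont (\<lambda>z. gibbs_avg V (hamiltonian V h K (y(j := z))) f) z"
  using gibbs_avg_has_derivative_field[OF assms] by (rule DERIV_isCont)

lemma measurable_gibbs_avg:
  assumes V: "finite V" and H: "\<And>\<sigma>. \<sigma> \<in> configs V \<Longrightarrow> (\<lambda>x. H x \<sigma>) \<in> borel_measurable M"
  shows "(\<lambda>x. gibbs_avg V (H x) f) \<in> borel_measurable M"
  unfolding gibbs_avg_eq_sum[OF V] using H by measurable

section \<open>Gaussian integration by parts\<close>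

abbreviation std_normal :: "real measure" where
  "std_normal \<equiv> density lborel (\<lambda>x. ennreal (std_normal_density x))"

lemma prob_space_std_normal: "prob_space std_normal"
  by (rule prob_space_normal_density) simp

lemma integrable_std_normal_id: "integrable std_normal (\<lambda>z. z)"
  using integrable_std_normal_moment[of 1] by (simp add: integrable_density)

text \<open>Makes the boundary terms of the integration by parts vanish.\<close>

lemma std_normal_density_tendsto_0:
  "(std_normal_density \<longlongrightarrow> 0) at_top" "(std_normal_density \<longlongrightarrow> 0) at_bot"
  unfolding std_normal_density_def[abs_def] by real_asymp+

text \<open>The density \<open>d\<close> satisfies d'(z) = -z d(z), so both sides differ by the
  integral of the derivative of \<open>d * f\<close> over the line. The bounds on \<open>f\<close>
  and \<open>f'\<close> make the two terms integrable separately.\<close>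

lemma std_normal_integration_by_parts:
  fixes f f' :: "real \<Rightarrow> real"
  assumes deriv: "\<And>z. (f has_real_derivative f' z) (at z)"
    and cont: "\<And>z. isCont f' z"
    and B: "\<And>z. \<bar>f z\<bar> \<le> B" and B': "\<And>z. \<bar>f' z\<bar> \<le> B'"
  shows "(\<integral>z. z * f z \<partial>std_normal) = (\<integral>z. f' z \<partial>std_normal)"
proof -
  let ?d = std_normal_density
  have cf: "isCont f z" for z
    using deriv by (rule DERIV_isCont)
  have meas [measurable]: "f \<in> borel_measurable borel" "f' \<in> borel_measurable borel"
    using cf cont by (auto intro!: borel_measurable_continuous_onI continuous_at_imp_continuous_on)
  have int1: "integrable lborel (\<lambda>z. ?d z * f' z)"
  proof (rule Bochner_Integration.integrable_bound)
    show "integrable lborel (\<lambda>z. B' * ?d z)" by simp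
    show "AE z in lborel. norm (?d z * f' z) \<le> norm (B' * ?d z)"
      using B' order_trans[OF abs_ge_zero B']
      by (auto simp: abs_mult mult.commute intro!: mult_right_mono)
  qed simp
  have int2: "integrable lborel (\<lambda>z. ?d z * (z * f z))"
  proof (rule Bochner_Integration.integrable_bound)
    show "integrable lborel (\<lambda>z. B * (?d z * \<bar>z\<bar>))"
      using integrable_std_normal_moment_abs[of 1] by simp
    have "\<bar>f z\<bar> * (?d z * \<bar>z\<bar>) \<le> B * (?d z * \<bar>z\<bar>)" for z
      using B by (intro mult_right_mono) auto
    then show "AE z in lborel. norm (?d z * (z * f z)) \<le> norm (B * (?d z * \<bar>z\<bar>))"
      using order_trans[OF abs_ge_zero B] by (intro AE_I2) (simp add: abs_mult mult_ac)
  qed simp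
  have dd: "((\<lambda>z. ?d z * f z) has_real_derivative ?d z * f' z - ?d z * (z * f z)) (at z)" for z
    unfolding std_normal_density_def
    by (rule derivative_eq_intros deriv refl | simp add: field_simps)+
  \<comment> \<open>Boundedness of \<open>f\<close> lets the product inherit the decay of the
    density.\<close>
  have lim: "((\<lambda>z. ?d z * f z) \<longlongrightarrow> 0) F" if "(?d \<longlongrightarrow> 0) F" for F
  proof (rule tendsto_0_le[OF that, of _ B])
    show "\<forall>\<^sub>F z in F. norm (?d z * f z) \<le> norm (?d z) * B"
      using B by (auto simp: abs_mult intro!: always_eventually mult_left_mono)
  qed
  have "(LBINT z=-\<infinity>..\<infinity>. ?d z * f' z - ?d z * (z * f z)) = 0 - 0"
  proof (rule interval_integral_FTC_integrable)
    show "((\<lambda>z. ?d z * f z) has_vector_derivative ?d z * f' z - ?d z * (z * f z)) (at z)" for z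
      using dd by (simp add: has_real_derivative_iff_has_vector_derivative)
    show "isCont (\<lambda>z. ?d z * f' z - ?d z * (z * f z)) z" for z
      unfolding std_normal_density_def by (intro continuous_intros cf cont) auto
    show "set_integrable lborel (einterval (- \<infinity>) \<infinity>) (\<lambda>z. ?d z * f' z - ?d z * (z * f z))"
      using int1 int2 by (simp add: set_integrable_def)
    show "(((\<lambda>z. ?d z * f z) \<circ> real_of_ereal) \<longlongrightarrow> 0) (at_right (- \<infinity>))"
      "(((\<lambda>z. ?d z * f z) \<circ> real_of_ereal) \<longlongrightarrow> 0) (at_left \<infinity>)"
      unfolding ereal_tendsto_simps1 by (intro lim std_normal_density_tendsto_0)+
  qed simp
  then have "(\<integral>z. ?d z * f' z - ?d z * (z * f z) \<partial>lborel) = 0"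
    by (simp add: interval_lebesgue_integral_def set_lebesgue_integral_def)
  then show ?thesis
    using int1 int2 by (simp add: integral_density)
qed

text \<open>By Fubini everything except coordinate \<open>j\<close> is frozen and the
  one-dimensional identity is applied to that coordinate. The factor \<open>M\<close> will carry the
  law of \<open>H'\<close>.\<close>

lemma (in prob_space) PiM_std_normal_integration_by_parts:
  fixes \<phi> \<phi>' :: "'a \<times> ('v \<Rightarrow> real) \<Rightarrow> real"
  defines "G \<equiv> \<lambda>V. \<Pi>\<^sub>M i\<in>V. std_normal"
  assumes V: "finite V" "j \<in> V"
    and [measurable]: "\<phi> \<in> borel_measurable (M \<Otimes>\<^sub>M G V)" "\<phi>' \<in> borel_measurable (M \<Otimes>\<^sub>M G V)"
    and deriv: "\<And>x y z. ((\<lambda>z. \<phi> (x, y(j := z))) has_real_derivative \<phi>' (x, y(j := z))) (at z)"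
    and cont: "\<And>x y z. isCont (\<lambda>z. \<phi>' (x, y(j := z))) z"
    and B: "\<And>p. \<bar>\<phi> p\<bar> \<le> B" and B': "\<And>p. \<bar>\<phi>' p\<bar> \<le> B'"
  shows "integrable (M \<Otimes>\<^sub>M G V) (\<lambda>p. snd p j * \<phi> p)"
    and "(\<integral>p. snd p j * \<phi> p \<partial>(M \<Otimes>\<^sub>M G V)) = (\<integral>p. \<phi>' p \<partial>(M \<Otimes>\<^sub>M G V))"
proof -
  interpret N: prob_space std_normal
    by (rule prob_space_std_normal)
  interpret P: product_prob_space "\<lambda>_. std_normal" UNIV
    by unfold_locales
  have G: "prob_space (G I)" for I
    unfolding G_def by (rule prob_space_PiM) (rule prob_space_std_normal)
  interpret GV: prob_space "G V"
    by (rule G)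
  interpret MG: pair_prob_space M "G V" ..
  \<comment> \<open>Coordinate \<open>j\<close> is standard normal, hence integrable;
    \<open>B\<close> times it dominates the unbounded integrand.\<close>
  have coord: "integrable (G V) (\<lambda>y. y j)"
  proof -
    have "distr (G V) std_normal (\<lambda>y. y j) = std_normal"
      unfolding G_def using V by (intro distr_PiM_component prob_space_std_normal)
    then have "integrable (distr (G V) std_normal (\<lambda>y. y j)) (\<lambda>z. z)"
      using integrable_std_normal_id by simp
    then show ?thesis
      by (rule integrable_distr[rotated]) (use V in \<open>simp add: G_def\<close>)
  qed
  have coord': "integrable (M \<Otimes>\<^sub>M G V) (\<lambda>p. snd p j)"
  proof -
    have "(\<lambda>p. snd p j) \<in> borel_measurable (M \<Otimes>\<^sub>M G V)"
      using measurable_compose[OF measurable_snd[of M "G V"] borel_measurable_integrable[OF coord]] by simp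
    then show ?thesis
      by (rule MG.Fubini_integrable) (use coord in auto)
  qed
  have [measurable]: "(\<lambda>p. snd p j) \<in> borel_measurable (M \<Otimes>\<^sub>M G V)"
    using coord' by simp
  show int: "integrable (M \<Otimes>\<^sub>M G V) (\<lambda>p. snd p j * \<phi> p)"
  proof (rule Bochner_Integration.integrable_bound)
    show "integrable (M \<Otimes>\<^sub>M G V) (\<lambda>p. B * snd p j)"
      using coord' by simp
    show "AE p in M \<Otimes>\<^sub>M G V. norm (snd p j * \<phi> p) \<le> norm (B * snd p j)"
      using B order_trans[OF abs_ge_zero B]
      by (auto simp: abs_mult mult.commute[of B] intro!: mult_left_mono)
  qed simp
  have int': "integrable (M \<Otimes>\<^sub>M G V) \<phi>'"
    by (rule MG.P.integrable_const_bound[where B = B']) (use B' in auto)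
  have V': "finite (V - {j})" "j \<notin> V - {j}"
    using V by auto
  \<comment> \<open>Integrability of the slice is a premise because Fubini provides it only for
    almost every \<open>x\<close>.\<close>
  have slice: "(\<integral>y. y j * \<phi> (x, y) \<partial>G V) = (\<integral>y. \<phi>' (x, y) \<partial>G V)"
    if x: "x \<in> space M" "integrable (G V) (\<lambda>y. y j * \<phi> (x, y))" for x
  proof -
    have "integrable (G V) (\<lambda>y. \<phi>' (x, y))"
      by (rule GV.integrable_const_bound[where B = B']) (use B' x in auto)
    \<comment> \<open>Viewing \<open>V\<close> as \<open>j\<close> inserted into
      \<open>V - {j}\<close> makes the integral over coordinate \<open>j\<close> the inner
      one.\<close>
    then have "(\<integral>y. \<phi>' (x, y) \<partial>G V) = (\<integral>y. (\<integral>z. \<phi>' (x, y(j := z)) \<partial>std_normal) \<partial>G (V - {j}))"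
      using P.product_integral_insert[OF V', of "\<lambda>y. \<phi>' (x, y)"] by (simp add: insert_absorb[OF V(2)] G_def)
    also have "\<dots> = (\<integral>y. (\<integral>z. (y(j := z)) j * \<phi> (x, y(j := z)) \<partial>std_normal) \<partial>G (V - {j}))"
      using std_normal_integration_by_parts[OF deriv cont B B'] by simp
    also have "\<dots> = (\<integral>y. y j * \<phi> (x, y) \<partial>G V)"
      using P.product_integral_insert[OF V', of "\<lambda>y. y j * \<phi> (x, y)"] x(2)
      by (simp add: insert_absorb[OF V(2)] G_def)
    finally show ?thesis ..
  qed
  have "(\<integral>p. snd p j * \<phi> p \<partial>(M \<Otimes>\<^sub>M G V)) = (\<integral>x. (\<integral>y. y j * \<phi> (x, y) \<partial>G V) \<partial>M)"
    using MG.integral_fst'[OF int] by simp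
  also have "\<dots> = (\<integral>x. (\<integral>y. \<phi>' (x, y) \<partial>G V) \<partial>M)"
  proof (rule integral_cong_AE)
    show "AE x in M. (\<integral>y. y j * \<phi> (x, y) \<partial>G V) = (\<integral>y. \<phi>' (x, y) \<partial>G V)"
      using MG.AE_integrable_fst'[OF int] AE_space by eventually_elim (simp add: slice)
  qed (use MG.integrable_fst'[OF int] MG.integrable_fst'[OF int'] in simp_all)
  also have "\<dots> = (\<integral>p. \<phi>' p \<partial>(M \<Otimes>\<^sub>M G V))"
    using MG.integral_fst'[OF int'] by simp
  finally show "(\<integral>p. snd p j * \<phi> p \<partial>(M \<Otimes>\<^sub>M G V)) = (\<integral>p. \<phi>' p \<partial>(M \<Otimes>\<^sub>M G V))" .
qed

section \<open>The random field Hamiltonian\<close>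

text \<open>The library's \<open>indep_var_distribution_eq\<close> covers only variables with a common value type.\<close>

lemma (in prob_space) distr_indep_rvs:
  assumes "indep_rvs M S X T Y"
  shows "distr M (S \<Otimes>\<^sub>M T) (\<lambda>\<omega>. (X \<omega>, Y \<omega>)) = distr M S X \<Otimes>\<^sub>M distr M T Y"
proof -
  have [measurable]: "X \<in> M \<rightarrow>\<^sub>M S" "Y \<in> M \<rightarrow>\<^sub>M T"
    and ind: "indep_set (sigma_sets (space M) {X -` A \<inter> space M | A. A \<in> sets S})
      (sigma_sets (space M) {Y -` A \<inter> space M | A. A \<in> sets T})"
    using assms unfolding indep_rvs_def by auto
  interpret X: prob_space "distr M S X" by (rule prob_space_distr) simp
  interpret Y: prob_space "distr M T Y" by (rule prob_space_distr) simp
  have "distr M S X \<Otimes>\<^sub>M distr M T Y = distr M (S \<Otimes>\<^sub>M T) (\<lambda>\<omega>. (X \<omega>, Y \<omega>))"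
  \<comment> \<open>It suffices to compare the measures on rectangles, where the claim is the
    product rule for independent events.\<close>
  proof (rule pair_measure_eqI)
    show "sigma_finite_measure (distr M S X)" "sigma_finite_measure (distr M T Y)" ..
    fix A B assume "A \<in> sets (distr M S X)" "B \<in> sets (distr M T Y)"
    then have [measurable]: "A \<in> sets S" "B \<in> sets T" by auto
    have "prob ((X -` A \<inter> space M) \<inter> (Y -` B \<inter> space M))
        = prob (X -` A \<inter> space M) * prob (Y -` B \<inter> space M)"
      by (rule indep_setD[OF ind]) (auto intro!: sigma_sets.Basic)
    moreover have "(\<lambda>\<omega>. (X \<omega>, Y \<omega>)) -` (A \<times> B) \<inter> space M
        = (X -` A \<inter> space M) \<inter> (Y -` B \<inter> space M)"
      by auto
    ultimately show "emeasure (distr M S X) A * emeasure (distr M T Y) B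
        = emeasure (distr M (S \<Otimes>\<^sub>M T) (\<lambda>\<omega>. (X \<omega>, Y \<omega>))) (A \<times> B)"
      by (simp add: emeasure_distr emeasure_eq_measure ennreal_mult)
  qed simp
  then show ?thesis ..
qed

text \<open>Identifies the joint law of the disorder as a product with Gaussian coordinates, so
  expectations can be computed by integrating one field at a time.\<close>

lemma (in prob_space) distr_indep_field:
  fixes g :: "'v \<Rightarrow> 'a \<Rightarrow> real"
  assumes V: "V \<noteq> {}"
    and ind: "indep_vars (\<lambda>_. borel) g V"
    and norm: "\<And>i. i \<in> V \<Longrightarrow> distributed M lborel (g i) std_normal_density"
    and indep: "indep_rvs M S X (\<Pi>\<^sub>M i\<in>V. borel) (\<lambda>\<omega>. \<lambda>i\<in>V. g i \<omega>)"
  shows "distr M (S \<Otimes>\<^sub>M (\<Pi>\<^sub>M i\<in>V. borel)) (\<lambda>\<omega>. (X \<omega>, \<lambda>i\<in>V. g i \<omega>))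
    = distr M S X \<Otimes>\<^sub>M (\<Pi>\<^sub>M i\<in>V. std_normal)"
proof -
  have g: "random_variable borel (g i)" if "i \<in> V" for i
    using distributed_measurable[OF norm[OF that]] by simp
  have "distr M (\<Pi>\<^sub>M i\<in>V. borel) (\<lambda>\<omega>. \<lambda>i\<in>V. g i \<omega>) = (\<Pi>\<^sub>M i\<in>V. distr M borel (g i))"
    using indep_vars_iff_distr_eq_PiM'[OF V g] ind by simp
  also have "\<dots> = (\<Pi>\<^sub>M i\<in>V. std_normal)"
  proof (rule PiM_cong[OF refl])
    fix i assume "i \<in> V"
    \<comment> \<open>\<open>distributed\<close> refers to \<open>lborel\<close>, the product space
      to \<open>borel\<close>; the two have the same measurable sets.\<close>
    have "distr M borel (g i) = distr M lborel (g i)"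
      by (rule distr_cong) auto
    then show "distr M borel (g i) = std_normal"
      using distributed_distr_eq_density[OF norm[OF \<open>i \<in> V\<close>]] by simp
  qed
  finally show ?thesis
    using distr_indep_rvs[OF indep] by simp
qed

text \<open>Pulls the identity on the product space back to \<open>M\<close> along the map sending
  an outcome to its disorder.\<close>

lemma (in prob_space) field_integration_by_parts:
  fixes V :: "'v set" and h :: real and g :: "'v \<Rightarrow> 'a \<Rightarrow> real"
    and H' :: "'a \<Rightarrow> ('v \<Rightarrow> real) \<Rightarrow> real"
  defines "H \<equiv> \<lambda>\<omega>. hamiltonian V h (H' \<omega>) (\<lambda>i. g i \<omega>)"
  assumes V: "finite V" "j \<in> V"
    and ind: "indep_vars (\<lambda>_. borel) g V"
    and norm: "\<And>i. i \<in> V \<Longrightarrow> distributed M lborel (g i) std_normal_density"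
    and indep: "indep_rvs M
      (\<Pi>\<^sub>M \<sigma>\<in>configs V. borel) (\<lambda>\<omega>. \<lambda>\<sigma>\<in>configs V. H' \<omega> \<sigma>)
      (\<Pi>\<^sub>M i\<in>V. borel) (\<lambda>\<omega>. \<lambda>i\<in>V. g i \<omega>)"
    and B: "\<And>\<sigma>. \<sigma> \<in> configs V \<Longrightarrow> \<bar>f \<sigma>\<bar> \<le> B"
  shows "integrable M (\<lambda>\<omega>. g j \<omega> * gibbs_avg V (H \<omega>) f)"
    and "expectation (\<lambda>\<omega>. g j \<omega> * gibbs_avg V (H \<omega>) f)
      = h * expectation (\<lambda>\<omega>. gibbs_cov V (H \<omega>) f (\<lambda>\<sigma>. \<sigma> j))"
    and "integrable M (\<lambda>\<omega>. gibbs_cov V (H \<omega>) f (\<lambda>\<sigma>. \<sigma> j))"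
proof -
  let ?X = "\<lambda>\<omega>. \<lambda>\<sigma>\<in>configs V. H' \<omega> \<sigma>" and ?Y = "\<lambda>\<omega>. \<lambda>i\<in>V. g i \<omega>"
  let ?S = "\<Pi>\<^sub>M \<sigma>\<in>configs V. (borel :: real measure)"
  let ?T = "\<Pi>\<^sub>M i\<in>V. (borel :: real measure)"
  let ?G = "\<Pi>\<^sub>M i\<in>V. std_normal"
  let ?Hp = "\<lambda>p. hamiltonian V h (fst p) (snd p)"
  let ?\<phi> = "\<lambda>p. gibbs_avg V (?Hp p) f"
  let ?c = "\<lambda>p. gibbs_cov V (?Hp p) f (\<lambda>\<sigma>. \<sigma> j)"
  have XY: "?X \<in> M \<rightarrow>\<^sub>M ?S" "?Y \<in> M \<rightarrow>\<^sub>M ?T"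
    using indep unfolding indep_rvs_def by auto
  then have XY_pair: "(\<lambda>\<omega>. (?X \<omega>, ?Y \<omega>)) \<in> M \<rightarrow>\<^sub>M ?S \<Otimes>\<^sub>M ?T"
    by simp
  define P where "P = distr M ?S ?X"
  interpret P: prob_space P
    unfolding P_def using XY(1) by (rule prob_space_distr)
  have D: "distr M (?S \<Otimes>\<^sub>M ?T) (\<lambda>\<omega>. (?X \<omega>, ?Y \<omega>)) = P \<Otimes>\<^sub>M ?G"
    unfolding P_def using V by (intro distr_indep_field ind norm indep) auto
  \<comment> \<open>Measurability is checked on the Borel product and transferred to the product of
    the laws.\<close>
  have sets_PG: "sets (P \<Otimes>\<^sub>M ?G) = sets (?S \<Otimes>\<^sub>M ?T)"
    unfolding D[symmetric] by simp
  have avg_meas: "(\<lambda>p. gibbs_avg V (?Hp p) u) \<in> borel_measurable (?S \<Otimes>\<^sub>M ?T)" for u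
  proof (rule measurable_gibbs_avg[OF V(1)])
    fix \<sigma> :: "'v \<Rightarrow> real" assume "\<sigma> \<in> configs V"
    then show "(\<lambda>p. ?Hp p \<sigma>) \<in> borel_measurable (?S \<Otimes>\<^sub>M ?T)"
      unfolding hamiltonian_def by measurable
  qed
  then have cov_meas: "?c \<in> borel_measurable (?S \<Otimes>\<^sub>M ?T)"
    unfolding gibbs_cov_def by measurable
  \<comment> \<open>Gibbs averages see \<open>H'\<close> only on \<open>configs V\<close> and
    \<open>g\<close> only on \<open>V\<close>, so restricting them changes nothing.\<close>
  have H_eq: "gibbs_avg V (?Hp (?X \<omega>, ?Y \<omega>)) u = gibbs_avg V (H \<omega>) u" for \<omega> u
    by (rule gibbs_avg_cong[OF V(1)]) (auto simp: H_def hamiltonian_def)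
  then have cov_eq: "?c (?X \<omega>, ?Y \<omega>) = gibbs_cov V (H \<omega>) f (\<lambda>\<sigma>. \<sigma> j)" for \<omega>
    unfolding gibbs_cov_def by simp
  have cov_bound: "\<bar>gibbs_cov V K f (\<lambda>\<sigma>. \<sigma> j)\<bar> \<le> 2 * (B * 1)" for K
    using V by (intro abs_gibbs_cov_le B) (auto intro: abs_config_le)
  have avg_meas': "?\<phi> \<in> borel_measurable (P \<Otimes>\<^sub>M ?G)"
    and cov_meas': "(\<lambda>p. h * ?c p) \<in> borel_measurable (P \<Otimes>\<^sub>M ?G)"
    using avg_meas cov_meas by (simp_all add: measurable_cong_sets[OF sets_PG refl])
  have bound: "\<bar>h * ?c p\<bar> \<le> \<bar>h\<bar> * (2 * (B * 1))" for p
    unfolding abs_mult[of h] by (intro mult_left_mono cov_bound) simp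
  have deriv: "((\<lambda>z. ?\<phi> (x, y(j := z))) has_real_derivative h * ?c (x, y(j := z))) (at z)" for x y z
    using gibbs_avg_has_derivative_field[OF V] by simp
  have cont: "isCont (\<lambda>z. h * ?c (x, y(j := z))) z" for x y z
    unfolding gibbs_cov_def by (simp add: isCont_gibbs_avg_field[OF V])
  have ibp: "integrable (P \<Otimes>\<^sub>M ?G) (\<lambda>p. snd p j * ?\<phi> p)"
    "(\<integral>p. snd p j * ?\<phi> p \<partial>(P \<Otimes>\<^sub>M ?G)) = (\<integral>p. h * ?c p \<partial>(P \<Otimes>\<^sub>M ?G))"
    by (rule P.PiM_std_normal_integration_by_parts[OF V avg_meas' cov_meas'];
        (rule deriv cont abs_gibbs_avg_le[OF V(1) B] bound; assumption?))+
  have meas: "(\<lambda>p. snd p j * ?\<phi> p) \<in> borel_measurable (?S \<Otimes>\<^sub>M ?T)"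
    using avg_meas V by measurable
  show "integrable M (\<lambda>\<omega>. g j \<omega> * gibbs_avg V (H \<omega>) f)"
    using ibp(1) V unfolding D[symmetric] integrable_distr_eq[OF XY_pair meas] H_eq by simp
  show "expectation (\<lambda>\<omega>. g j \<omega> * gibbs_avg V (H \<omega>) f)
      = h * expectation (\<lambda>\<omega>. gibbs_cov V (H \<omega>) f (\<lambda>\<sigma>. \<sigma> j))"
    using ibp(2) V cov_meas
    unfolding D[symmetric] integral_distr[OF XY_pair meas] H_eq
    by (simp add: integral_distr[OF XY_pair] cov_eq[simplified])
  have "(\<lambda>\<omega>. gibbs_cov V (H \<omega>) f (\<lambda>\<sigma>. \<sigma> j)) \<in> borel_measurable M"
    using measurable_compose[OF XY_pair cov_meas] unfolding cov_eq .
  then show "integrable M (\<lambda>\<omega>. gibbs_cov V (H \<omega>) f (\<lambda>\<sigma>. \<sigma> j))"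
    by (intro integrable_const_bound[where B = "2 * (B * 1)"] AE_I2) (use cov_bound in auto)
qed

section \<open>Bound on the expected total covariance\<close>

lemma (in prob_space) sum_std_normal_second_moment:
  fixes g :: "'v \<Rightarrow> 'a \<Rightarrow> real"
  assumes "finite V" "V \<noteq> {}"
    and "indep_vars (\<lambda>_. borel) g V"
    and "\<And>i. i \<in> V \<Longrightarrow> distributed M lborel (g i) std_normal_density"
  shows "integrable M (\<lambda>\<omega>. (\<Sum>i\<in>V. g i \<omega>)\<^sup>2)"
    and "expectation (\<lambda>\<omega>. (\<Sum>i\<in>V. g i \<omega>)\<^sup>2) = real (card V)"
proof -
  let ?s = "sqrt (real (card V))"
  have s: "?s > 0"
    using assms by (simp add: card_gt_0_iff)
  have D: "distributed M lborel (\<lambda>\<omega>. \<Sum>i\<in>V. g i \<omega>) (normal_density 0 ?s)"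
    using sum_indep_normal[of V g "\<lambda>_. 1" "\<lambda>_. 0"] assms by simp
  show "integrable M (\<lambda>\<omega>. (\<Sum>i\<in>V. g i \<omega>)\<^sup>2)"
    using distributed_integrable[OF D, of "\<lambda>x. x\<^sup>2"] integrable_normal_moment[OF s, of 0 2] by simp
  \<comment> \<open>The sum is centred, so its second moment is its variance.\<close>
  show "expectation (\<lambda>\<omega>. (\<Sum>i\<in>V. g i \<omega>)\<^sup>2) = real (card V)"
    using normal_distributed_variance[OF s D] normal_distributed_expectation[OF s D] by simp
qed

lemma (in prob_space) expectation_sum_cov_le:
  fixes V :: "'v set" and h :: real and g :: "'v \<Rightarrow> 'a \<Rightarrow> real"
    and H' :: "'a \<Rightarrow> ('v \<Rightarrow> real) \<Rightarrow> real"
  defines "H \<equiv> \<lambda>\<omega>. hamiltonian V h (H' \<omega>) (\<lambda>i. g i \<omega>)"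
  assumes V: "finite V" "V \<noteq> {}" and h: "h > 0"
    and ind: "indep_vars (\<lambda>_. borel) g V"
    and norm: "\<And>i. i \<in> V \<Longrightarrow> distributed M lborel (g i) std_normal_density"
    and indep: "indep_rvs M
      (\<Pi>\<^sub>M \<sigma>\<in>configs V. borel) (\<lambda>\<omega>. \<lambda>\<sigma>\<in>configs V. H' \<omega> \<sigma>)
      (\<Pi>\<^sub>M i\<in>V. borel) (\<lambda>\<omega>. \<lambda>i\<in>V. g i \<omega>)"
  shows "integrable M (\<lambda>\<omega>. \<Sum>i\<in>V. \<Sum>j\<in>V. gibbs_cov V (H \<omega>) (\<lambda>\<sigma>. \<sigma> i) (\<lambda>\<sigma>. \<sigma> j))"
    and "expectation (\<lambda>\<omega>. \<Sum>i\<in>V. \<Sum>j\<in>V. gibbs_cov V (H \<omega>) (\<lambda>\<sigma>. \<sigma> i) (\<lambda>\<sigma>. \<sigma> j))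
      \<le> real (card V) * sqrt (real (card V)) / h"
proof -
  let ?n = "real (card V)"
  let ?f = "\<lambda>\<sigma>. \<Sum>i\<in>V. \<sigma> i"
  let ?A = "\<lambda>\<omega>. gibbs_avg V (H \<omega>) ?f"
  let ?W = "\<lambda>\<omega>. \<Sum>j\<in>V. g j \<omega>"
  have n: "?n > 0"
    using V by (simp add: card_gt_0_iff)
  \<comment> \<open>This bound serves twice: as the constant \<open>B\<close> in the integration by
    parts and as the bound on \<open>?A\<close>.\<close>
  have f: "\<bar>?f \<sigma>\<bar> \<le> ?n" if "\<sigma> \<in> configs V" for \<sigma>
  proof -
    have "\<bar>?f \<sigma>\<bar> \<le> (\<Sum>i\<in>V. \<bar>\<sigma> i\<bar>)"
      by (rule sum_abs)
    also have "\<dots> \<le> ?n"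
      using sum_bounded_above[of V "\<lambda>i. \<bar>\<sigma> i\<bar>" 1] abs_config_le[OF that] by simp
    finally show ?thesis .
  qed
  have H: "hamiltonian V h (H' \<omega>) (\<lambda>i. g i \<omega>) = H \<omega>" for \<omega>
    by (simp add: H_def)
  note ibp = field_integration_by_parts[OF V(1) _ ind norm indep f, where h = h, unfolded H]
  \<comment> \<open>Linearity in the first argument absorbs one sum into the total spin, leaving one
    integration by parts per site \<open>j\<close>.\<close>
  have sum_cov: "(\<Sum>i\<in>V. \<Sum>j\<in>V. gibbs_cov V (H \<omega>) (\<lambda>\<sigma>. \<sigma> i) (\<lambda>\<sigma>. \<sigma> j))
      = (\<Sum>j\<in>V. gibbs_cov V (H \<omega>) ?f (\<lambda>\<sigma>. \<sigma> j))" for \<omega>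
    unfolding gibbs_cov_sum[OF V(1)] by (rule sum.swap)
  show "integrable M (\<lambda>\<omega>. \<Sum>i\<in>V. \<Sum>j\<in>V. gibbs_cov V (H \<omega>) (\<lambda>\<sigma>. \<sigma> i) (\<lambda>\<sigma>. \<sigma> j))"
    unfolding sum_cov using ibp(3) by simp
  note W2 = sum_std_normal_second_moment[OF V ind norm]
  have "h * expectation (\<lambda>\<omega>. \<Sum>i\<in>V. \<Sum>j\<in>V. gibbs_cov V (H \<omega>) (\<lambda>\<sigma>. \<sigma> i) (\<lambda>\<sigma>. \<sigma> j))
      = (\<Sum>j\<in>V. h * expectation (\<lambda>\<omega>. gibbs_cov V (H \<omega>) ?f (\<lambda>\<sigma>. \<sigma> j)))"
    unfolding sum_cov using ibp(3) by (simp add: sum_distrib_left)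
  also have "\<dots> = (\<Sum>j\<in>V. expectation (\<lambda>\<omega>. g j \<omega> * ?A \<omega>))"
    using ibp(2) by simp
  also have "\<dots> = expectation (\<lambda>\<omega>. ?W \<omega> * ?A \<omega>)"
    using ibp(1) by (simp add: sum_distrib_right)
  \<comment> \<open>AM-GM in the form \<open>2 \<bar>W\<bar> \<le> W\<^sup>2 / \<surd>n + \<surd>n\<close> replaces the first absolute moment by the second.\<close>
  also have "\<dots> \<le> expectation (\<lambda>\<omega>. ?n * (((?W \<omega>)\<^sup>2 / sqrt ?n + sqrt ?n) / 2))"
  proof (rule integral_mono)
    show "integrable M (\<lambda>\<omega>. ?W \<omega> * ?A \<omega>)"
      using ibp(1) by (simp add: sum_distrib_right)
    show "integrable M (\<lambda>\<omega>. ?n * (((?W \<omega>)\<^sup>2 / sqrt ?n + sqrt ?n) / 2))"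
      using W2(1) by simp
    fix \<omega>
    have "?W \<omega> * ?A \<omega> \<le> \<bar>?W \<omega>\<bar> * \<bar>?A \<omega>\<bar>"
      unfolding abs_mult[symmetric] by (rule abs_ge_self)
    also have "\<dots> \<le> \<bar>?W \<omega>\<bar> * ?n"
      by (intro mult_left_mono abs_gibbs_avg_le V f) auto
    also have "\<dots> \<le> ((?W \<omega>)\<^sup>2 / sqrt ?n + sqrt ?n) / 2 * ?n"
    proof (rule mult_right_mono)
      have "2 * \<bar>?W \<omega>\<bar> * sqrt ?n \<le> (?W \<omega>)\<^sup>2 + (sqrt ?n)\<^sup>2"
        using sum_squares_bound[of "\<bar>?W \<omega>\<bar>" "sqrt ?n"] by simp
      then show "\<bar>?W \<omega>\<bar> \<le> ((?W \<omega>)\<^sup>2 / sqrt ?n + sqrt ?n) / 2"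
        using n by (simp add: divide_simps power2_eq_square mult_ac del: real_sqrt_mult_self)
    qed simp
    finally show "?W \<omega> * ?A \<omega> \<le> ?n * (((?W \<omega>)\<^sup>2 / sqrt ?n + sqrt ?n) / 2)"
      by (simp add: mult.commute)
  qed
  \<comment> \<open>Since the second moment of \<open>?W\<close> is \<open>?n\<close>, both summands
    have expectation \<open>sqrt ?n\<close>, and so does half their sum.\<close>
  also have "\<dots> = ?n * sqrt ?n"
    using W2 n by (simp add: prob_space real_div_sqrt)
  finally show "expectation (\<lambda>\<omega>. \<Sum>i\<in>V. \<Sum>j\<in>V. gibbs_cov V (H \<omega>) (\<lambda>\<sigma>. \<sigma> i) (\<lambda>\<sigma>. \<sigma> j))
      \<le> ?n * sqrt ?n / h"
    using h by (simp add: pos_le_divide_eq mult.commute)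
qed

theorem theorem3:
  fixes M :: "'w measure"
    and V :: "'v set"
    and h :: real
    and H' :: "'w \<Rightarrow> ('v \<Rightarrow> real) \<Rightarrow> real"
    and g :: "'v \<Rightarrow> 'w \<Rightarrow> real"
    and H :: "'w \<Rightarrow> ('v \<Rightarrow> real) \<Rightarrow> real"
  defines "H \<equiv> \<lambda>\<omega>. hamiltonian V h (H' \<omega>) (\<lambda>i. g i \<omega>)"
  assumes "prob_space M"
    and "finite V" and "V \<noteq> {}"
    and "h > 0"
    and "prob_space.indep_vars M (\<lambda>_. borel) g V"
    and "\<And>i. i \<in> V \<Longrightarrow> distributed M lborel (g i) std_normal_density"
    and "indep_rvs M
           (\<Pi>\<^sub>M \<sigma>\<in>configs V. borel) (\<lambda>\<omega>. \<lambda>\<sigma>\<in>configs V. H' \<omega> \<sigma>)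
           (\<Pi>\<^sub>M i\<in>V. borel) (\<lambda>\<omega>. \<lambda>i\<in>V. g i \<omega>)"
    and "AE \<omega> in M. \<forall>i\<in>V. \<forall>j\<in>V.
           gibbs_avg V (H \<omega>) (\<lambda>\<sigma>. \<sigma> i * \<sigma> j)
             \<ge> gibbs_avg V (H \<omega>) (\<lambda>\<sigma>. \<sigma> i) * gibbs_avg V (H \<omega>) (\<lambda>\<sigma>. \<sigma> j)"
  shows "prob_space.expectation M (\<lambda>\<omega>.
           gibbs_avg2 V (H \<omega>)
             (\<lambda>\<sigma>1 \<sigma>2. (overlap V \<sigma>1 \<sigma>2 - gibbs_avg2 V (H \<omega>) (overlap V))\<^sup>2))
         \<le> 2 / (h * sqrt (real (card V)))"
proof -
  interpret prob_space M by fact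
  let ?n = "real (card V)"
  let ?C = "\<lambda>\<omega>. \<Sum>i\<in>V. \<Sum>j\<in>V. gibbs_cov V (H \<omega>) (\<lambda>\<sigma>. \<sigma> i) (\<lambda>\<sigma>. \<sigma> j)"
  have H: "hamiltonian V h (H' \<omega>) (\<lambda>i. g i \<omega>) = H \<omega>" for \<omega>
    by (simp add: H_def)
  note C = expectation_sum_cov_le[OF assms(3-8), unfolded H]
  have n: "?n > 0"
    using assms(3,4) by (simp add: card_gt_0_iff)
  have pos: "AE \<omega> in M. \<forall>i\<in>V. \<forall>j\<in>V. gibbs_cov V (H \<omega>) (\<lambda>\<sigma>. \<sigma> i) (\<lambda>\<sigma>. \<sigma> j) \<ge> 0"
    using assms(9) by (simp add: gibbs_cov_def)
  have "expectation (\<lambda>\<omega>. gibbs_avg2 V (H \<omega>)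
          (\<lambda>\<sigma>1 \<sigma>2. (overlap V \<sigma>1 \<sigma>2 - gibbs_avg2 V (H \<omega>) (overlap V))\<^sup>2))
      \<le> expectation (\<lambda>\<omega>. 2 / ?n\<^sup>2 * ?C \<omega>)"
  \<comment> \<open>Integrability is shown for the upper bound alone; its nonnegativity covers the
    default value 0 of the integral of a non-integrable function.\<close>
  proof (rule integral_mono_AE')
    show "integrable M (\<lambda>\<omega>. 2 / ?n\<^sup>2 * ?C \<omega>)"
      using C(1) by simp
    show "AE \<omega> in M. gibbs_avg2 V (H \<omega>)
          (\<lambda>\<sigma>1 \<sigma>2. (overlap V \<sigma>1 \<sigma>2 - gibbs_avg2 V (H \<omega>) (overlap V))\<^sup>2) \<le> 2 / ?n\<^sup>2 * ?C \<omega>"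
      using pos by eventually_elim (intro overlap_variance_le assms(3), blast)
    show "AE \<omega> in M. 0 \<le> 2 / ?n\<^sup>2 * ?C \<omega>"
      using pos by eventually_elim (intro mult_nonneg_nonneg sum_nonneg, auto)
  qed
  also have "\<dots> = 2 / ?n\<^sup>2 * expectation ?C"
    by simp
  also have "\<dots> \<le> 2 / ?n\<^sup>2 * (?n * sqrt ?n / h)"
    using C(2) by (intro mult_left_mono) auto
  also have "\<dots> = 2 / (h * sqrt ?n)"
    using n assms(5) by (simp add: field_simps power2_eq_square)
  finally show ?thesis .
qed

end
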